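(* Let $G$ be a countably infinite discrete group and $H\leq G$ a subgroup. Let $(X,H,\alpha)$ be a topological dynamical system where $X$ contains at least two distinct points, and let $(X_H^G,G,\alpha^{H\backslash G})$ be its co-induced system. If $[G:H]=+\infty$, then $$IN_k\left(X_H^G,G\right)=\left(X_H^G\right)^k$$ for all $k\in\mathbb{N}$, and $h_{top}^*(X_H^G,G)=+\infty$.
   Context: A topological dynamical system (t.d.s.) $(X,G,\alpha)$ consists of a compact metric space $X$, a group $G$, and an action $(g,x)\mapsto\alpha_g(x)$ of $G$ on $X$ by homeomorphisms. $\mathbb{N}=\{1,2,\dots\}$ and $[k]=\{1,\dots,k\}$. Co-induced system: let $H\leq G$, let $H\backslash G$ be the set of right cosets $Hg$, and fix a section $s:H\backslash G\to G$ (so $s(\theta)\in\theta$) with $s(H)=e$. Given a t.d.s. $(X,H,\alpha)$, put $X_H^G=\prod_{\theta\in H\backslash G}X$ (functions $f:H\backslash G\to X$, product topology), with $G$-action $$\alpha^{H\backslash G}_{g_0}(f)(Hg)=\alpha_{s(Hg)g_0s(Hgg_0)^{-1}}\big(f(Hgg_0)\big).$$ Up to conjugacy of $G$-systems this does not depend on the section $s$. A set $I\subseteq G$ is an independence set for a tuple $(A_1,\dots,A_k)$ of subsets of a $G$-system $X$ if $\bigcap_{g\in F}\alpha_{g^{-1}}(A_{\omega(g)})\neq\emptyset$ for every non-empty finite $F\subseteq I$ and every function $\omega:F\to[k]$. A tuple $(x_1,\dots,x_k)\in X^k$ is an $IN$-tuple if for every product neighborhood $U_1\times\dots\times U_k$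 of it the tuple $(U_1,\dots,U_k)$ has arbitrarily large finite independence sets. $IN_k(X,G)$ denotes the set of $IN$-tuples of length $k$. Maximal pattern entropy: for an open cover $\mathcal{U}$ of $X$, let $N(\mathcal{U})$ be the minimal cardinality of a subcover, and $$p^*_{X,G,\mathcal{U}}(n)=\max_{(g_1,\dots,g_n)\in G^n}N\Big(\bigvee_{i=1}^n\alpha_{g_i^{-1}}(\mathcal{U})\Big),\quad h_{top}^*(\mathcal{U},G)=\lim_{n\to\infty}\frac1n\log p^*_{X,G,\mathcal{U}}(n),$$ $$h_{top}^*(X,G)=\sup_{\mathcal{U}}h_{top}^*(\mathcal{U},G),$$ the supremum being over all open covers of $X$. *)

theory Defs
  imports "HOL-Analysis.Analysis" "HOL-Algebra.Group_Action"
begin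

text \<open>The actions of \<^locale>\<open>group_action\<close> are left actions by bijections that are extensional
  on the space, i.e. take the value \<^const>\<open>undefined\<close> outside of it.\<close>

locale tds = group_action G "topspace X" \<alpha>
  for G (structure) and X :: "'x topology" and \<alpha> +
  assumes compact: "compact_space X"
    and metrizable: "metrizable_space X"
    and homeomorphic: "g \<in> carrier G \<Longrightarrow> homeomorphic_map X X (\<alpha> g)"

definition coset_section :: "('g, 'm) monoid_scheme \<Rightarrow> 'g set \<Rightarrow> ('g set \<Rightarrow> 'g) \<Rightarrow> bool" where
  "coset_section G H s \<longleftrightarrow> (\<forall>\<theta> \<in> rcosets\<^bsub>G\<^esub> H. s \<theta> \<in> \<theta>) \<and> s H = \<one>\<^bsub>G\<^esub>"

definition coind_space :: "('g, 'm) monoid_scheme \<Rightarrow> 'g set \<Rightarrow> 'x topology \<Rightarrow> ('g set \<Rightarrow> 'x) topology" where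
  "coind_space G H X = product_topology (\<lambda>_. X) (rcosets\<^bsub>G\<^esub> H)"

text \<open>For \<open>\<theta> = Hg\<close>, the coset \<open>Hgg\<^sub>0\<close> is the translate \<open>\<theta> #> g\<^sub>0\<close>.\<close>

definition coind_action ::
  "('g, 'm) monoid_scheme \<Rightarrow> 'g set \<Rightarrow> ('g set \<Rightarrow> 'g) \<Rightarrow> 'x topology \<Rightarrow> ('g \<Rightarrow> 'x \<Rightarrow> 'x)
    \<Rightarrow> 'g \<Rightarrow> ('g set \<Rightarrow> 'x) \<Rightarrow> ('g set \<Rightarrow> 'x)" where
  "coind_action G H s X \<alpha> g\<^sub>0 =
     (\<lambda>f \<in> topspace (coind_space G H X). \<lambda>\<theta> \<in> rcosets\<^bsub>G\<^esub> H.
        \<alpha> (s \<theta> \<otimes>\<^bsub>G\<^esub> g\<^sub>0 \<otimes>\<^bsub>G\<^esub> inv\<^bsub>G\<^esub> (s (\<theta> #>\<^bsub>G\<^esub> g\<^sub>0))) (f (\<theta> #>\<^bsub>G\<^esub> g\<^sub>0)))"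

context
  fixes G :: "('g, 'm) monoid_scheme" (structure) and H s and X :: "'x topology" and \<alpha>
  assumes G: "group G" and H: "subgroup H G" and s: "coset_section G H s"
    and X: "tds (G\<lparr>carrier := H\<rparr>) X \<alpha>"
begin

interpretation G: group G by (rule G)
interpretation H: subgroup H G by (rule H)
interpretation X: tds "G\<lparr>carrier := H\<rparr>" X \<alpha> by (rule X)

lemma coset_translate:
  assumes "\<theta> \<in> rcosets H" "g \<in> carrier G"
  shows "\<theta> #> g \<in> rcosets H"
proof -
  obtain a where a: "a \<in> carrier G" "\<theta> = H #> a" using assms by (auto simp: RCOSETS_def)
  have "\<theta> #> g = H #> (a \<otimes> g)" using a assms H.subset by (simp add: G.coset_mult_assoc)
  then show ?thesis using a assms H.subset by (simp add: G.rcosetsI)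
qed

lemma section_carrier: "\<theta> \<in> rcosets H \<Longrightarrow> s \<theta> \<in> carrier G"
  using s H.rcosets_carrier[OF G] by (auto simp: coset_section_def)

lemma section_coset: "\<theta> \<in> rcosets H \<Longrightarrow> H #> s \<theta> = \<theta>"
  using s G.repr_independence[OF _ _ H] by (auto simp: coset_section_def RCOSETS_def)

lemma cocycle_mem:
  assumes "\<theta> \<in> rcosets H" "g \<in> carrier G"
  shows "s \<theta> \<otimes> g \<otimes> inv (s (\<theta> #> g)) \<in> H"
proof -
  have c: "s \<theta> \<in> carrier G" "s (\<theta> #> g) \<in> carrier G"
    using assms coset_translate section_carrier by auto
  have "H #> (s \<theta> \<otimes> g) = \<theta> #> g"
    using assms c section_coset[of \<theta>] G.coset_mult_assoc[OF H.subset, of "s \<theta>" g] by simp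
  also have "\<dots> = H #> s (\<theta> #> g)" using section_coset coset_translate assms by simp
  finally have "s \<theta> \<otimes> g \<in> H #> s (\<theta> #> g)" using G.rcos_self[OF _ H] assms c by auto
  then show ?thesis using c assms H.rcos_module_imp[OF G] by auto
qed

lemma act_closed: "h \<in> H \<Longrightarrow> x \<in> topspace X \<Longrightarrow> \<alpha> h x \<in> topspace X"
  using X.element_image[of h x] by simp

lemma act_mult: "h \<in> H \<Longrightarrow> k \<in> H \<Longrightarrow> x \<in> topspace X \<Longrightarrow> \<alpha> (h \<otimes> k) x = \<alpha> h (\<alpha> k x)"
  using X.composition_rule[of x h k] by simp

lemma coind_closed:
  assumes "g \<in> carrier G" "f \<in> topspace (coind_space G H X)"
  shows "coind_action G H s X \<alpha> g f \<in> topspace (coind_space G H X)"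
  using assms coset_translate cocycle_mem
  by (auto simp: coind_action_def coind_space_def PiE_iff intro!: act_closed)

lemma coind_one:
  assumes "f \<in> topspace (coind_space G H X)"
  shows "coind_action G H s X \<alpha> \<one> f = f"
proof -
  have e: "\<theta> #> \<one> = \<theta>" if "\<theta> \<in> rcosets H" for \<theta>
    using that H.rcosets_carrier[OF G] by (intro G.coset_mult_one) auto
  have a1: "\<alpha> \<one> x = x" if "x \<in> topspace X" for x
    using fun_cong[OF X.id_eq_one, of x] that by simp
  show ?thesis using assms e a1 section_carrier
    by (auto simp: coind_action_def coind_space_def PiE_iff extensional_def fun_eq_iff)
qed

lemma coind_mult:
  assumes "g \<in> carrier G" "h \<in> carrier G" "f \<in> topspace (coind_space G H X)"
  shows "coind_action G H s X \<alpha> (g \<otimes> h) f = coind_action G H s X \<alpha> g (coind_action G H s X \<alpha> h f)"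
proof
  fix \<theta>
  show "coind_action G H s X \<alpha> (g \<otimes> h) f \<theta> = coind_action G H s X \<alpha> g (coind_action G H s X \<alpha> h f) \<theta>"
  proof (cases "\<theta> \<in> rcosets H")
    case True
    have t: "\<theta> #> g \<in> rcosets H" "\<theta> #> g #> h \<in> rcosets H" "\<theta> #> (g \<otimes> h) = \<theta> #> g #> h"
      using True assms coset_translate H.rcosets_carrier[OF G True] by (auto simp: G.coset_mult_assoc)
    have c: "s \<theta> \<in> carrier G" "s (\<theta> #> g) \<in> carrier G" "s (\<theta> #> g #> h) \<in> carrier G"
      using section_carrier True t by auto
    have "s \<theta> \<otimes> (g \<otimes> h) \<otimes> inv (s (\<theta> #> g #> h))
       = (s \<theta> \<otimes> g \<otimes> inv (s (\<theta> #> g))) \<otimes> (s (\<theta> #> g) \<otimes> h \<otimes> inv (s (\<theta> #> g #> h)))"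
      using c assms by (simp add: G.m_assoc G.inv_solve_left') (metis G.inv_closed G.inv_solve_left G.m_assoc G.m_closed)
    moreover have "f (\<theta> #> g #> h) \<in> topspace X" using assms t by (auto simp: coind_space_def)
    ultimately show ?thesis
      using assms True t coind_closed[OF assms(2,3)] cocycle_mem[OF True assms(1)] cocycle_mem[OF t(1) assms(2)]
      by (simp add: coind_action_def act_mult)
  next
    case False
    then show ?thesis using assms coind_closed[OF assms(2,3)] by (simp add: coind_action_def)
  qed
qed

lemma coind_continuous:
  assumes "g \<in> carrier G"
  shows "continuous_map (coind_space G H X) (coind_space G H X) (coind_action G H s X \<alpha> g)"
proof -
  have "continuous_map (coind_space G H X) X (\<lambda>f. coind_action G H s X \<alpha> g f \<theta>)"
    if t: "\<theta> \<in> rcosets H" for \<theta>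
  proof -
    have "continuous_map (coind_space G H X) X (\<lambda>f. f (\<theta> #> g))"
      unfolding coind_space_def using coset_translate[OF t assms]
      by (rule continuous_map_product_projection)
    moreover have "continuous_map X X (\<alpha> (s \<theta> \<otimes> g \<otimes> inv (s (\<theta> #> g))))"
      using X.homeomorphic cocycle_mem[OF t assms] by (simp add: homeomorphic_imp_continuous_map)
    ultimately have "continuous_map (coind_space G H X) X (\<alpha> (s \<theta> \<otimes> g \<otimes> inv (s (\<theta> #> g))) \<circ> (\<lambda>f. f (\<theta> #> g)))"
      by (rule continuous_map_compose)
    then show ?thesis
      by (rule continuous_map_eq) (use t in \<open>simp add: coind_action_def\<close>)
  qed
  then show ?thesis
    unfolding coind_space_def[where X=X]
    using coind_closed[OF assms]
    by (auto simp: continuous_map_componentwise coind_space_def PiE_iff)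
qed

lemma coind_homeo:
  assumes "g \<in> carrier G"
  shows "homeomorphic_map (coind_space G H X) (coind_space G H X) (coind_action G H s X \<alpha> g)"
proof -
  have "homeomorphic_maps (coind_space G H X) (coind_space G H X) (coind_action G H s X \<alpha> g) (coind_action G H s X \<alpha> (inv g))"
    using assms coind_continuous coind_one coind_mult[of g "inv g"] coind_mult[of "inv g" g]
    by (auto simp: homeomorphic_maps_def)
  then show ?thesis using homeomorphic_map_maps by blast
qed

lemma coind_tds:
  assumes "countable (carrier G)"
  shows "tds G (coind_space G H X) (coind_action G H s X \<alpha>)"
proof -
  have B: "coind_action G H s X \<alpha> g \<in> Bij (topspace (coind_space G H X))" if "g \<in> carrier G" for g
    using coind_homeo[OF that]
    by (auto simp: Bij_def bij_betw_def homeomorphic_eq_everything_map) (auto simp: coind_action_def)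
  have "group_action G (topspace (coind_space G H X)) (coind_action G H s X \<alpha>)"
    unfolding group_action_def group_hom_def group_hom_axioms_def
  proof (intro conjI G group_BijGroup homI)
    fix g h assume gh: "g \<in> carrier G" "h \<in> carrier G"
    have "coind_action G H s X \<alpha> (g \<otimes> h) = compose (topspace (coind_space G H X)) (coind_action G H s X \<alpha> g) (coind_action G H s X \<alpha> h)"
      using gh coind_mult by (auto simp: compose_def fun_eq_iff coind_action_def)
    then show "coind_action G H s X \<alpha> (g \<otimes> h) = coind_action G H s X \<alpha> g \<otimes>\<^bsub>BijGroup (topspace (coind_space G H X))\<^esub> coind_action G H s X \<alpha> h"
      using B gh by (simp add: BijGroup_def)
  qed (use B in \<open>simp add: BijGroup_def\<close>)
  moreover have "countable (rcosets H)" using assms by (simp add: RCOSETS_def)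
  then have "metrizable_space (coind_space G H X)"
    using X.metrizable by (simp add: coind_space_def metrizable_space_product_topology)
  moreover have "compact_space (coind_space G H X)"
    using X.compact by (simp add: coind_space_def compact_space_product_topology)
  ultimately show ?thesis using coind_homeo by (simp add: tds_def tds_axioms_def)
qed
end

definition independence_set ::
  "('g, 'm) monoid_scheme \<Rightarrow> ('g \<Rightarrow> 'x \<Rightarrow> 'x) \<Rightarrow> nat \<Rightarrow> (nat \<Rightarrow> 'x set) \<Rightarrow> 'g set \<Rightarrow> bool" where
  "independence_set G \<alpha> k A I \<longleftrightarrow> I \<subseteq> carrier G \<and>
     (\<forall>F \<omega>. F \<subseteq> I \<and> finite F \<and> F \<noteq> {} \<and> \<omega> \<in> F \<rightarrow> {1..k} \<longrightarrow>
        (\<Inter>g\<in>F. \<alpha> (inv\<^bsub>G\<^esub> g) ` A (\<omega> g)) \<noteq> {})"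

definition IN_tuples ::
  "nat \<Rightarrow> 'x topology \<Rightarrow> ('g, 'm) monoid_scheme \<Rightarrow> ('g \<Rightarrow> 'x \<Rightarrow> 'x) \<Rightarrow> (nat \<Rightarrow> 'x) set" where
  "IN_tuples k X G \<alpha> = {x \<in> {1..k} \<rightarrow>\<^sub>E topspace X.
     \<forall>U. (\<forall>i\<in>{1..k}. U i \<subseteq> topspace X \<and> x i \<in> X interior_of (U i)) \<longrightarrow>
         (\<forall>n. \<exists>I. finite I \<and> n \<le> card I \<and> independence_set G \<alpha> k U I)}"

definition open_cover :: "'x topology \<Rightarrow> 'x set set \<Rightarrow> bool" where
  "open_cover X \<U> \<longleftrightarrow> (\<forall>U\<in>\<U>. openin X U) \<and> \<Union>\<U> = topspace X"

definition cover_number :: "'x topology \<Rightarrow> 'x set set \<Rightarrow> nat" where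
  "cover_number X \<U> =
     (LEAST n. \<exists>\<V>. \<V> \<subseteq> \<U> \<and> finite \<V> \<and> card \<V> = n \<and> \<Union>\<V> = topspace X)"

definition cover_join :: "nat \<Rightarrow> (nat \<Rightarrow> 'x set set) \<Rightarrow> 'x set set" where
  "cover_join n \<C> = {\<Inter>i\<in>{1..n}. V i | V. \<forall>i\<in>{1..n}. V i \<in> \<C> i}"

text \<open>The maximum runs over infinitely many tuples \<open>g\<close>, but only over finitely many numbers,
  all bounded by \<open>cover_number X \<U> ^ n\<close>.\<close>

definition max_pattern ::
  "'x topology \<Rightarrow> ('g, 'm) monoid_scheme \<Rightarrow> ('g \<Rightarrow> 'x \<Rightarrow> 'x) \<Rightarrow> 'x set set \<Rightarrow> nat \<Rightarrow> nat" where
  "max_pattern X G \<alpha> \<U> n =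
     Max {cover_number X (cover_join n (\<lambda>i. (`) (\<alpha> (inv\<^bsub>G\<^esub> (g i))) ` \<U>)) | g.
            g \<in> {1..n} \<rightarrow> carrier G}"

definition cover_pattern_entropy ::
  "'x topology \<Rightarrow> ('g, 'm) monoid_scheme \<Rightarrow> ('g \<Rightarrow> 'x \<Rightarrow> 'x) \<Rightarrow> 'x set set \<Rightarrow> real" where
  "cover_pattern_entropy X G \<alpha> \<U> =
     lim (\<lambda>n. 1 / real n * ln (real (max_pattern X G \<alpha> \<U> n)))"

definition max_pattern_entropy ::
  "'x topology \<Rightarrow> ('g, 'm) monoid_scheme \<Rightarrow> ('g \<Rightarrow> 'x \<Rightarrow> 'x) \<Rightarrow> ereal" where
  "max_pattern_entropy X G \<alpha> =
     (SUP \<U> \<in> {\<U>. open_cover X \<U>}. ereal (cover_pattern_entropy X G \<alpha> \<U>))"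

end

theory Submission imports Defs begin

text \<open>The subgroup \<open>H\<close> has infinite index, so P. M. Neumann's separation lemma provides, for every finite
  set \<open>E\<close> of cosets, arbitrarily many group elements \<open>g\<close> whose translates \<open>Eg\<close> are pairwise disjoint.
  Since \<open>(gf)(\<theta>)\<close> depends only on \<open>f(\<theta>g)\<close>, such elements are independent for any sets that
  contain cylinders over \<open>E\<close>; hence every tuple is an IN-tuple. For the entropy, \<open>k\<close> distinct points
  have disjoint closed neighbourhoods \<open>A\<^sub>1, \<dots>, A\<^sub>k\<close>, and the cover by the \<open>k\<close> sets obtained by removing
  all but one of the \<open>A\<^sub>i\<close> has exactly \<open>k\<^sup>n\<close> as its maximal pattern count, because each of its
  members meets only one of the \<open>A\<^sub>i\<close>. The space is infinite, so \<open>k\<close> is arbitrary.\<close>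

section \<open>Separation of finite sets of cosets\<close>

lemma (in group) rcoset_translate_closed:
  assumes "subgroup H G" "\<theta> \<in> rcosets H" "g \<in> carrier G"
  shows "\<theta> #> g \<in> rcosets H"
proof -
  obtain a where a: "a \<in> carrier G" "\<theta> = H #> a" using assms by (auto simp: RCOSETS_def)
  then have "\<theta> #> g = H #> (a \<otimes> g)"
    using assms(1,3) subgroup.subset[of H G] by (simp add: coset_mult_assoc)
  then show ?thesis using a assms by (simp add: rcosetsI subgroup.subset)
qed

lemma (in group) rcoset_translate_mult:
  assumes "subgroup H G" "\<theta> \<in> rcosets H" "g \<in> carrier G" "h \<in> carrier G"
  shows "\<theta> #> g #> h = \<theta> #> (g \<otimes> h)"
  using assms subgroup.rcosets_carrier[OF assms(1) is_group assms(2)] by (simp add: coset_mult_assoc)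

lemma (in group) rcoset_translate_inv:
  assumes "subgroup H G" "\<theta> \<in> rcosets H" "g \<in> carrier G"
  shows "\<theta> #> g #> inv g = \<theta>" "\<theta> #> inv g #> g = \<theta>"
  using assms subgroup.rcosets_carrier[OF assms(1) is_group assms(2)]
  by (simp_all add: coset_mult_assoc)

lemma (in group) rcosets_transitive:
  assumes "subgroup H G" "\<theta> \<in> rcosets H" "\<theta>' \<in> rcosets H"
  obtains g where "g \<in> carrier G" "\<theta> #> g = \<theta>'"
proof -
  obtain a b where ab: "a \<in> carrier G" "\<theta> = H #> a" "b \<in> carrier G" "\<theta>' = H #> b"
    using assms by (auto simp: RCOSETS_def)
  then have "\<theta> #> (inv a \<otimes> b) = \<theta>'"
    using assms(1) subgroup.subset[of H G] by (simp add: coset_mult_assoc m_assoc[symmetric])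
  then show thesis using that[of "inv a \<otimes> b"] ab by simp
qed

text \<open>The induction on \<open>E\<close> leaves \<open>F\<close> arbitrary because its
  hypothesis is applied to a larger forbidden set \<open>F'\<close>. Only the new coset
  \<open>e\<close> can then still land in \<open>F\<close>, and one further translation repairs
  that.\<close>

lemma (in group) rcosets_separation:
  assumes H: "subgroup H G" and inf: "infinite (rcosets H)"
    and "finite E" "E \<subseteq> rcosets H" "finite F"
  shows "\<exists>g \<in> carrier G. \<forall>\<theta> \<in> E. \<theta> #> g \<notin> F"
  using assms(3-5)
proof (induction arbitrary: F)
  case empty
  then show ?case by auto
next
  case (insert e E)
  obtain f' where f': "f' \<in> rcosets H" "f' \<notin> F"
    using inf insert.prems by (meson finite_subset subsetI)
  \<comment> \<open>\<open>F\<close> may contain sets that are not cosets; the guard makes the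
    choice of \<open>x\<close> total on all of them, with \<one> as a possible value there.\<close>
  have "\<exists>x. x \<in> carrier G \<and> (f \<in> rcosets H \<longrightarrow> f #> x = f')" for f
    using rcosets_transitive[OF H _ f'(1)] one_closed by metis
  then obtain x where x: "\<And>f. x f \<in> carrier G" "\<And>f. f \<in> rcosets H \<Longrightarrow> f #> x f = f'"
    by metis
  \<comment> \<open>If \<open>g\<close> moves \<open>e\<close> to a point \<open>f\<close> of \<open>F\<close>, then \<open>g \<otimes> x f\<close> moves it to \<open>f'\<close>; enlarging \<open>F\<close> ensures that
    this correction keeps the rest of the set away from \<open>F\<close>.\<close>
  define F' where "F' = F \<union> (\<Union>f\<in>F. (\<lambda>\<theta>. \<theta> #> inv (x f)) ` F)"
  have "finite F'" using insert.prems by (auto simp: F'_def)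
  then obtain g where g: "g \<in> carrier G" "\<And>\<theta>. \<theta> \<in> E \<Longrightarrow> \<theta> #> g \<notin> F'"
    using insert by (meson insert_subset)
  show ?case
  proof (cases "e #> g \<in> F")
    case False
    then show ?thesis using g by (auto simp: F'_def)
  next
    case True
    let ?x = "x (e #> g)"
    have "e \<in> rcosets H" using insert.prems by auto
    then have "e #> (g \<otimes> ?x) = f'"
      using g(1) x rcoset_translate_closed[OF H] rcoset_translate_mult[OF H] by metis
    moreover have "\<theta> #> (g \<otimes> ?x) \<notin> F" if "\<theta> \<in> E" for \<theta>
    proof
      assume F: "\<theta> #> (g \<otimes> ?x) \<in> F"
      have \<theta>: "\<theta> \<in> rcosets H" using that insert.prems by auto
      have "\<theta> #> (g \<otimes> ?x) #> inv ?x = \<theta> #> g"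
        using \<theta> g(1) x(1) rcoset_translate_closed[OF H] rcoset_translate_mult[OF H]
          rcoset_translate_inv[OF H] by metis
      then have "\<theta> #> g \<in> F'" using F True unfolding F'_def by force
      then show False using g(2) that by blast
    qed
    ultimately show ?thesis using g(1) x(1) f'(2) by (intro bexI[of _ "g \<otimes> ?x"]) auto
  qed
qed

text \<open>Greedy construction: the next element comes from \<open>rcosets_separation\<close>, with
  the finitely many cosets in the earlier translates of \<open>E\<close> as forbidden set.\<close>

lemma (in group) rcosets_disjoint_translates:
  assumes H: "subgroup H G" and inf: "infinite (rcosets H)"
    and E: "finite E" "E \<subseteq> rcosets H" "E \<noteq> {}"
  shows "\<exists>I. finite I \<and> card I = n \<and> I \<subseteq> carrier G \<and>
    (\<forall>g\<in>I. \<forall>g'\<in>I. \<forall>\<theta>\<in>E. \<forall>\<theta>'\<in>E. \<theta> #> g = \<theta>' #> g' \<longrightarrow> g = g')"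
proof (induction n)
  case 0
  show ?case by (intro exI[of _ "{}"]) auto
next
  case (Suc n)
  then obtain I where I: "finite I" "card I = n" "I \<subseteq> carrier G"
    "\<forall>g\<in>I. \<forall>g'\<in>I. \<forall>\<theta>\<in>E. \<forall>\<theta>'\<in>E. \<theta> #> g = \<theta>' #> g' \<longrightarrow> g = g'" by auto
  have "finite ((\<lambda>(\<theta>, g). \<theta> #> g) ` (E \<times> I))" using I E by auto
  from rcosets_separation[OF H inf E(1,2) this]
  obtain g where g: "g \<in> carrier G" "\<And>\<theta> \<theta>' g'. \<theta> \<in> E \<Longrightarrow> \<theta>' \<in> E \<Longrightarrow> g' \<in> I \<Longrightarrow> \<theta> #> g \<noteq> \<theta>' #> g'"
    by fastforce
  \<comment> \<open>For \<open>g\<close> in \<open>I\<close>, any \<theta> in the non-empty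
    \<open>E\<close> would give the forbidden coincidence of \<open>\<theta> #> g\<close> with
    itself.\<close>
  moreover have "g \<notin> I" using g(2) E(3) by blast
  ultimately show ?case using I by (intro exI[of _ "insert g I"]) (auto; metis)
qed

section \<open>IN-tuples of the co-induced system\<close>

text \<open>A basic open box around \<open>z\<close> inside \<open>S\<close> constrains only
  finitely many coordinates; these form \<open>E\<close>.\<close>

lemma openin_product_contains_cylinder:
  assumes "openin (product_topology X I) S" "z \<in> S"
  shows "\<exists>E. finite E \<and> E \<subseteq> I \<and>
    (\<forall>f \<in> topspace (product_topology X I). (\<forall>i\<in>E. f i = z i) \<longrightarrow> f \<in> S)"
proof -
  obtain U where U: "finite {i \<in> I. U i \<noteq> topspace (X i)}" "z \<in> Pi\<^sub>E I U" "Pi\<^sub>E I U \<subseteq> S"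
    using assms unfolding openin_product_topology_alt by meson
  show ?thesis
  proof (intro exI[of _ "{i \<in> I. U i \<noteq> topspace (X i)}"] conjI ballI impI)
    fix f assume f: "f \<in> topspace (product_topology X I)"
      and fz: "\<forall>i\<in>{i \<in> I. U i \<noteq> topspace (X i)}. f i = z i"
    have "f i \<in> U i" if "i \<in> I" for i
      using f fz U(2) that by (cases "U i = topspace (X i)") (auto simp: PiE_iff)
    then have "f \<in> Pi\<^sub>E I U" using f by (auto simp: PiE_iff)
    then show "f \<in> S" using U(3) by blast
  qed (use U in auto)
qed

context
  fixes G :: "('g, 'm) monoid_scheme" (structure) and H s and X :: "'x topology" and \<alpha>
  assumes G: "group G" and H: "subgroup H G" and s: "coset_section G H s"
    and X: "tds (G\<lparr>carrier := H\<rparr>) X \<alpha>"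
begin

interpretation group G by (rule G)

private abbreviation (input) "Y \<equiv> coind_space G H X"
private abbreviation (input) "\<beta> \<equiv> coind_action G H s X \<alpha>"

lemma coind_inv:
  assumes "g \<in> carrier G" "f \<in> topspace Y"
  shows "\<beta> g (\<beta> (inv g) f) = f" "\<beta> (inv g) (\<beta> g f) = f"
  using coind_mult[OF G H s X, of g "inv g" f] coind_mult[OF G H s X, of "inv g" g f]
    coind_one[OF G H s X assms(2)] assms by simp_all

lemma coind_local:
  assumes "g \<in> carrier G" "f \<in> topspace Y" "f' \<in> topspace Y" "\<theta> \<in> rcosets H"
    and "f (\<theta> #> g) = f' (\<theta> #> g)"
  shows "\<beta> g f \<theta> = \<beta> g f' \<theta>"
  using assms by (simp add: coind_action_def)

text \<open>By \<open>coind_local\<close>, a condition on \<open>\<beta> g f \<theta>\<close>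
  concerns \<open>f\<close> at \<open>\<theta> #> g\<close> only, and copying
  \<open>\<beta> (inv g) (z g)\<close> there satisfies it. Disjointness of the translates keeps the
  conditions for different \<open>g\<close> from competing for a coset.\<close>

lemma coind_prescribe:
  assumes "I \<subseteq> carrier G" and E: "E \<subseteq> rcosets H" and p: "p \<in> topspace Y"
    and disj: "\<And>g g' \<theta> \<theta>'. \<lbrakk>g \<in> I; g' \<in> I; \<theta> \<in> E; \<theta>' \<in> E; \<theta> #> g = \<theta>' #> g'\<rbrakk> \<Longrightarrow> g = g'"
    and z: "\<And>g. g \<in> I \<Longrightarrow> z g \<in> topspace Y"
  obtains f where "f \<in> topspace Y" "\<And>g \<theta>. g \<in> I \<Longrightarrow> \<theta> \<in> E \<Longrightarrow> \<beta> g f \<theta> = z g \<theta>"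
proof -
  define P where "P \<theta> g \<longleftrightarrow> g \<in> I \<and> \<theta> \<in> (\<lambda>\<theta>. \<theta> #> g) ` E" for \<theta> g
  \<comment> \<open>By \<open>disj\<close>, at most one \<open>g\<close> satisfies
    \<open>P \<theta> g\<close>, so \<open>SOME\<close> recovers it; \<open>p\<close> fills the
    unconstrained coordinates.\<close>
  define f where "f \<theta> = (if \<exists>g. P \<theta> g then \<beta> (inv (SOME g. P \<theta> g)) (z (SOME g. P \<theta> g)) \<theta> else p \<theta>)" for \<theta>
  have P: "(SOME g. P \<theta> g) \<in> I \<and> \<theta> \<in> (\<lambda>\<theta>'. \<theta>' #> (SOME g. P \<theta> g)) ` E" if "\<exists>g. P \<theta> g" for \<theta>
    using someI_ex[OF that] unfolding P_def .
  have c: "\<beta> (inv g) (z g) \<in> topspace Y" if "g \<in> I" for g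
    using coind_closed[OF G H s X] that assms(1) z by auto
  \<comment> \<open>Points of the product are extensional. Translates of cosets are cosets, so off
    the index set \<open>f\<close> agrees with \<open>p\<close>.\<close>
  have ext: "f \<theta> = undefined" if "\<theta> \<notin> rcosets H" for \<theta>
  proof -
    have "\<not> (\<exists>g. P \<theta> g)" using that E assms(1) rcoset_translate_closed[OF H] by (auto simp: P_def)
    then show ?thesis using p that by (auto simp: f_def coind_space_def PiE_iff extensional_def)
  qed
  have "f \<theta> \<in> topspace X" if "\<theta> \<in> rcosets H" for \<theta>
  proof (cases "\<exists>g. P \<theta> g")
    case True
    then show ?thesis using c[of "SOME g. P \<theta> g"] P[OF True] that
      by (auto simp: f_def coind_space_def PiE_iff)
  next
    case False
    then show ?thesis using p that by (auto simp: f_def coind_space_def PiE_iff)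
  qed
  with ext have f: "f \<in> topspace Y" by (auto simp: coind_space_def PiE_iff extensional_def)
  moreover have "\<beta> g f \<theta> = z g \<theta>" if g: "g \<in> I" and \<theta>: "\<theta> \<in> E" for g \<theta>
  proof -
    have ex: "P (\<theta> #> g) g" using g \<theta> by (auto simp: P_def)
    then have "(SOME g'. P (\<theta> #> g) g') = g"
      using P[of "\<theta> #> g"] disj g \<theta> by blast
    then have "f (\<theta> #> g) = \<beta> (inv g) (z g) (\<theta> #> g)" using ex by (auto simp: f_def)
    then have "\<beta> g f \<theta> = \<beta> g (\<beta> (inv g) (z g)) \<theta>"
      using f c[OF g] g \<theta> E assms(1) by (intro coind_local) auto
    then show ?thesis using coind_inv z g assms(1) by auto
  qed
  ultimately show thesis using that by blast
qed

lemma IN_tuples_coind: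
  assumes inf: "infinite (rcosets H)"
  shows "IN_tuples k Y G \<beta> = ({1..k} \<rightarrow>\<^sub>E topspace Y)"
proof -
  have "\<exists>I. finite I \<and> n \<le> card I \<and> independence_set G \<beta> k U I"
    if x: "x \<in> {1..k} \<rightarrow>\<^sub>E topspace Y"
      and U: "\<And>i. i \<in> {1..k} \<Longrightarrow> U i \<subseteq> topspace Y \<and> x i \<in> Y interior_of (U i)" for x U n
  proof -
    have "\<exists>E. finite E \<and> E \<subseteq> rcosets H \<and>
        (\<forall>f \<in> topspace Y. (\<forall>\<theta>\<in>E. f \<theta> = x i \<theta>) \<longrightarrow> f \<in> U i)" if "i \<in> {1..k}" for i
      using openin_product_contains_cylinder[of "\<lambda>_. X" "rcosets H" "Y interior_of U i" "x i"]
        U[OF that] interior_of_subset[of Y "U i"]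
      by (fastforce simp: coind_space_def)
    then obtain E where E: "\<And>i. i \<in> {1..k} \<Longrightarrow> finite (E i) \<and> E i \<subseteq> rcosets H \<and>
        (\<forall>f \<in> topspace Y. (\<forall>\<theta>\<in>E i. f \<theta> = x i \<theta>) \<longrightarrow> f \<in> U i)"
      by metis
    \<comment> \<open>Inserting \<open>H\<close> keeps \<open>E'\<close> non-empty even if every
      \<open>E i\<close> is empty, as \<open>rcosets_disjoint_translates\<close> demands.\<close>
    define E' where "E' = insert H (\<Union>i\<in>{1..k}. E i)"
    have "H \<in> rcosets H" using rcosetsI[OF subgroup.subset[OF H] one_closed] coset_mult_one[OF subgroup.subset[OF H]] by simp
    with E have E': "finite E'" "E' \<subseteq> rcosets H" "E' \<noteq> {}"
      unfolding E'_def by blast+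
    obtain I where I: "finite I" "card I = n" "I \<subseteq> carrier G"
      "\<forall>g\<in>I. \<forall>g'\<in>I. \<forall>\<theta>\<in>E'. \<forall>\<theta>'\<in>E'. \<theta> #> g = \<theta>' #> g' \<longrightarrow> g = g'"
      using rcosets_disjoint_translates[OF H inf E', of n] by blast
    have "(\<Inter>g\<in>F. \<beta> (inv g) ` U (\<omega> g)) \<noteq> {}"
      if F: "F \<subseteq> I" "F \<noteq> {}" and \<omega>: "\<omega> \<in> F \<rightarrow> {1..k}" for F \<omega>
    proof -
      have z: "x (\<omega> g) \<in> topspace Y" if "g \<in> F" for g
        using x \<omega> that by (metis PiE_mem Pi_mem)
      obtain p where "p \<in> topspace Y" using F z by blast
      moreover have "F \<subseteq> carrier G" using F I by auto
      ultimately obtain f where f: "f \<in> topspace Y"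
        "\<And>g \<theta>. g \<in> F \<Longrightarrow> \<theta> \<in> E' \<Longrightarrow> \<beta> g f \<theta> = x (\<omega> g) \<theta>"
        using coind_prescribe[of F E' p "\<lambda>g. x (\<omega> g)"] E'(2) I(4) F z by (metis subsetD)
      have "f \<in> \<beta> (inv g) ` U (\<omega> g)" if g: "g \<in> F" for g
      proof
        have gc: "g \<in> carrier G" using g F I by auto
        show "f = \<beta> (inv g) (\<beta> g f)" using coind_inv gc f by simp
        have "\<omega> g \<in> {1..k}" using \<omega> g by auto
        \<comment> \<open>\<open>\<beta> g f\<close> agrees with \<open>x (\<omega> g)\<close> on
          \<open>E'\<close>, hence on \<open>E (\<omega> g)\<close>, and so lies in the cylinder
          inside \<open>U (\<omega> g)\<close>.\<close>
        then show "\<beta> g f \<in> U (\<omega> g)"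
          using E[of "\<omega> g"] f(2)[OF g] coind_closed[OF G H s X gc f(1)] unfolding E'_def by blast
      qed
      then show ?thesis by blast
    qed
    then have "independence_set G \<beta> k U I" using I by (auto simp: independence_set_def)
    then show ?thesis using I by blast
  qed
  then show ?thesis by (auto simp: IN_tuples_def)
qed

end

section \<open>Entropy from independence\<close>

lemma independence_set_mono:
  "independence_set G \<alpha> k A I \<Longrightarrow> J \<subseteq> I \<Longrightarrow> independence_set G \<alpha> k A J"
  unfolding independence_set_def by (meson subset_trans)

text \<open>Indexing the join by words \<open>w\<close> over \<open>J\<close> makes its members
  countable in the sense of \<open>card_PiE\<close>; different words may still name the same
  set.\<close>

lemma cover_join_image:
  "cover_join n (\<lambda>i. (\<lambda>j. B i j) ` J) = (\<lambda>w. \<Inter>i\<in>{1..n}. B i (w i)) ` ({1..n} \<rightarrow>\<^sub>E J)"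
proof (intro equalityI subsetI)
  fix V assume "V \<in> cover_join n (\<lambda>i. (\<lambda>j. B i j) ` J)"
  then obtain W where V: "V = (\<Inter>i\<in>{1..n}. W i)" and W: "\<And>i. i \<in> {1..n} \<Longrightarrow> W i \<in> B i ` J"
    unfolding cover_join_def by auto
  define w where "w = (\<lambda>i\<in>{1..n}. SOME j. j \<in> J \<and> W i = B i j)"
  have w: "w i \<in> J \<and> W i = B i (w i)" if "i \<in> {1..n}" for i
    using someI_ex[of "\<lambda>j. j \<in> J \<and> W i = B i j"] W[OF that] that unfolding w_def by auto
  have "w \<in> {1..n} \<rightarrow>\<^sub>E J" using w by (intro PiE_I) (auto simp: w_def)
  moreover have "V = (\<Inter>i\<in>{1..n}. B i (w i))" unfolding V using w by (intro INF_cong) auto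
  ultimately show "V \<in> (\<lambda>w. \<Inter>i\<in>{1..n}. B i (w i)) ` ({1..n} \<rightarrow>\<^sub>E J)" by blast
next
  fix V assume "V \<in> (\<lambda>w. \<Inter>i\<in>{1..n}. B i (w i)) ` ({1..n} \<rightarrow>\<^sub>E J)"
  then obtain w where w: "w \<in> {1..n} \<rightarrow>\<^sub>E J" and V: "V = (\<Inter>i\<in>{1..n}. B i (w i))" by (rule imageE)
  have "\<forall>i\<in>{1..n}. B i (w i) \<in> B i ` J" using PiE_mem[OF w] by blast
  then show "V \<in> cover_join n (\<lambda>i. (\<lambda>j. B i j) ` J)" unfolding V cover_join_def by blast
qed

lemma cover_number_le:
  assumes "\<V> \<subseteq> \<U>" "finite \<V>" "\<Union>\<V> = topspace X"
  shows "cover_number X \<U> \<le> card \<V>"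
  unfolding cover_number_def using assms by (intro Least_le) blast

text \<open>A given finite subcover is what makes the \<open>LEAST\<close> in
  \<open>cover_number\<close> a value that is actually reached.\<close>

lemma cover_number_attained:
  assumes "\<V> \<subseteq> \<U>" "finite \<V>" "\<Union>\<V> = topspace X"
  obtains \<W> where "\<W> \<subseteq> \<U>" "finite \<W>" "card \<W> = cover_number X \<U>" "\<Union>\<W> = topspace X"
proof -
  have "\<exists>\<W>. \<W> \<subseteq> \<U> \<and> finite \<W> \<and> card \<W> = cover_number X \<U> \<and> \<Union>\<W> = topspace X"
    unfolding cover_number_def by (rule LeastI_ex) (use assms in blast)
  then show thesis using that by blast
qed

section \<open>Pattern counts and entropy of a general system\<close>

context tds
begin

interpretation group G by (rule group_hom.axioms(1)[OF group_hom])

lemma act_image_topspace: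
  assumes "g \<in> carrier G" shows "\<alpha> g ` topspace X = topspace X"
  using homeomorphic[OF assms] by (simp add: homeomorphic_imp_surjective_map)

lemma act_inj: "g \<in> carrier G \<Longrightarrow> inj_on (\<alpha> g) (topspace X)"
  using homeomorphic by (simp add: homeomorphic_map_def homeomorphic_eq_everything_map)

text \<open>For \<open>n = 0\<close> the only member would be the empty intersection
  \<open>UNIV\<close>; with \<open>n \<ge> 1\<close> the factor at index 1 keeps each member inside
  the space.\<close>

lemma join_covers:
  fixes n :: nat
  assumes n: "n \<ge> 1" and g: "g \<in> {1..n} \<rightarrow> carrier G" and U: "(\<Union>j\<in>J. U j) = topspace X"
  shows "(\<Union>w\<in>{1..n} \<rightarrow>\<^sub>E J. \<Inter>i\<in>{1..n}. \<alpha> (inv (g i)) ` U (w i)) = topspace X"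
proof (intro equalityI subsetI)
  fix p assume "p \<in> (\<Union>w\<in>{1..n} \<rightarrow>\<^sub>E J. \<Inter>i\<in>{1..n}. \<alpha> (inv (g i)) ` U (w i))"
  then obtain w where w: "w \<in> {1..n} \<rightarrow>\<^sub>E J" "p \<in> (\<Inter>i\<in>{1..n}. \<alpha> (inv (g i)) ` U (w i))"
    by (rule UN_E)
  have "p \<in> \<alpha> (inv (g 1)) ` U (w 1)" by (rule INT_D[OF w(2)]) (use n in simp)
  moreover have "w 1 \<in> J" by (rule PiE_mem[OF w(1)]) (use n in simp)
  then have "U (w 1) \<subseteq> topspace X" using U by blast
  moreover have "\<alpha> (inv (g 1)) ` topspace X = topspace X"
    using g n by (intro act_image_topspace inv_closed) auto
  ultimately show "p \<in> topspace X" by blast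
next
  fix p assume p: "p \<in> topspace X"
  have "\<exists>j\<in>J. p \<in> \<alpha> (inv (g i)) ` U j" if "i \<in> {1..n}" for i
  proof -
    have "inv (g i) \<in> carrier G" using Pi_mem[OF g that] by simp
    then have "p \<in> \<alpha> (inv (g i)) ` topspace X" using act_image_topspace p by simp
    then show ?thesis using U by blast
  qed
  then obtain w where "\<And>i. i \<in> {1..n} \<Longrightarrow> w i \<in> J \<and> p \<in> \<alpha> (inv (g i)) ` U (w i)" by metis
  then show "p \<in> (\<Union>w\<in>{1..n} \<rightarrow>\<^sub>E J. \<Inter>i\<in>{1..n}. \<alpha> (inv (g i)) ` U (w i))"
    by (intro UN_I[of "restrict w {1..n}"]) auto
qed

lemma max_pattern_eq:
  assumes n: "n \<ge> 1" and U: "(\<Union>j\<in>{1..k}. U j) = topspace X"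
    and A: "\<And>j. j \<in> {1..k} \<Longrightarrow> A j \<subseteq> topspace X"
    and sep: "\<And>i j. i \<in> {1..k} \<Longrightarrow> j \<in> {1..k} \<Longrightarrow> i \<noteq> j \<Longrightarrow> U i \<inter> A j = {}"
    and I: "finite I" "n \<le> card I" "independence_set G \<alpha> k A I"
  shows "max_pattern X G \<alpha> (U ` {1..k}) n = k ^ n"
proof -
  let ?W = "{1..n} \<rightarrow>\<^sub>E {1..k}"
  define V where "V g w = (\<Inter>i\<in>{1..n}. \<alpha> (inv (g i)) ` U (w i))" for g w
  define N where "N g = cover_number X (V g ` ?W)" for g
  have W: "finite ?W" "card ?W = k ^ n" by (auto simp: finite_PiE card_PiE)
  have cov: "\<Union>(V g ` ?W) = topspace X" if "g \<in> {1..n} \<rightarrow> carrier G" for g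
    using join_covers[OF n that U] by (simp add: V_def)
  have up: "N g \<le> k ^ n" if "g \<in> {1..n} \<rightarrow> carrier G" for g
    using cover_number_le[OF subset_refl _ cov[OF that]] card_image_le[OF W(1), of "V g"] W
    by (simp add: N_def)
  \<comment> \<open>Exactly \<open>n\<close> elements are kept, so that they can be enumerated
    injectively by \<open>g\<close> and every word on \<open>{1..n}\<close> becomes a map \<omega>
    on \<open>J\<close>.\<close>
  obtain J where J: "J \<subseteq> I" "card J = n" using obtain_subset_with_card_n[OF I(2)] by metis
  then have "finite J" using I finite_subset by blast
  then obtain g where g: "bij_betw g {1..n} J" using J(2) ex_bij_betw_nat_finite_1 by blast
  have JG: "independence_set G \<alpha> k A J" "J \<subseteq> carrier G"
    using independence_set_mono[OF I(3) J(1)] by (auto simp: independence_set_def)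
  then have gc: "g i \<in> carrier G" if "i \<in> {1..n}" for i using g that bij_betwE by blast
  then have gc': "g \<in> {1..n} \<rightarrow> carrier G" by blast
  have "\<exists>p\<in>topspace X. \<forall>i\<in>{1..n}. p \<in> \<alpha> (inv (g i)) ` A (w i)" if w: "w \<in> ?W" for w
  proof -
    let ?\<omega> = "\<lambda>h. w (the_inv_into {1..n} g h)"
    have gi: "the_inv_into {1..n} g (g i) = i" if "i \<in> {1..n}" for i
      using g that by (simp add: bij_betw_def the_inv_into_f_f)
    have "the_inv_into {1..n} g h \<in> {1..n}" if "h \<in> J" for h
      using g that by (metis bij_betw_the_inv_into bij_betwE)
    then have "?\<omega> \<in> J \<rightarrow> {1..k}" using w by auto
    moreover have "J \<noteq> {}" using J n by auto
    ultimately obtain p where p: "\<And>h. h \<in> J \<Longrightarrow> p \<in> \<alpha> (inv h) ` A (?\<omega> h)"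
      using JG \<open>finite J\<close> unfolding independence_set_def by (metis (no_types, lifting) INT_E equals0I subset_refl)
    have *: "p \<in> \<alpha> (inv (g i)) ` A (w i)" if "i \<in> {1..n}" for i
      using p[of "g i"] gi that g bij_betwE by fastforce
    moreover have "A (w 1) \<subseteq> topspace X" using A w n by (metis PiE_mem atLeastAtMost_iff order_refl)
    then have "\<alpha> (inv (g 1)) ` A (w 1) \<subseteq> topspace X"
      using n gc[of 1] act_image_topspace[of "inv (g 1)"] by (metis atLeastAtMost_iff image_mono inv_closed order_refl)
    then have "p \<in> topspace X" using *[of 1] n by auto
    ultimately show ?thesis by blast
  qed
  then obtain p where p: "\<And>w. w \<in> ?W \<Longrightarrow> p w \<in> topspace X"
    "\<And>w i. w \<in> ?W \<Longrightarrow> i \<in> {1..n} \<Longrightarrow> p w \<in> \<alpha> (inv (g i)) ` A (w i)" by metis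
  have dist: "w = w'" if w: "w \<in> ?W" "w' \<in> ?W" and pV: "p w \<in> V g w'" for w w'
  proof (rule PiE_ext[OF w])
    fix i assume i: "i \<in> {1..n}"
    then have k: "w i \<in> {1..k}" "w' i \<in> {1..k}" using w by (metis PiE_mem)+
    have "U (w' i) \<subseteq> topspace X" "A (w i) \<subseteq> topspace X" using U A k by blast+
    moreover have "p w \<in> \<alpha> (inv (g i)) ` A (w i) \<inter> \<alpha> (inv (g i)) ` U (w' i)"
      using p(2) w i pV by (auto simp: V_def)
    \<comment> \<open>Injectivity pulls the common point \<open>p w\<close> of the two images back
      to a point of \<open>U (w' i) \<inter> A (w i)\<close>, which \<open>sep\<close> allows only
      for equal letters.\<close>
    moreover have "inj_on (\<alpha> (inv (g i))) (topspace X)" using act_inj gc[OF i] by simp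
    ultimately have "U (w' i) \<inter> A (w i) \<noteq> {}" by (auto simp: inj_on_def) blast
    then show "w i = w' i" using sep k by metis
  qed
  have "k ^ n \<le> N g"
  proof -
    obtain \<W> where \<W>: "\<W> \<subseteq> V g ` ?W" "finite \<W>" "card \<W> = N g" "\<Union>\<W> = topspace X"
      using cover_number_attained[OF subset_refl _ cov[OF gc']] W(1) unfolding N_def by blast
    have "V g w \<in> \<W>" if w: "w \<in> ?W" for w
    proof -
      obtain S where S: "S \<in> \<W>" "p w \<in> S" using p(1)[OF w] \<W>(4) by blast
      then obtain w' where "w' \<in> ?W" "S = V g w'" using \<W>(1) by blast
      then show ?thesis using dist[OF w] S by blast
    qed
    \<comment> \<open>Some member contains \<open>p w\<close>, and \<open>dist\<close> forces it to
      be \<open>V g w\<close>. If \<open>V g w'\<close> is the same set, \<open>dist\<close> applies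
      once more.\<close>
    moreover have "inj_on (V g) ?W"
    proof
      fix w w' assume w: "w \<in> ?W" "w' \<in> ?W" and eq: "V g w = V g w'"
      obtain w'' where w'': "w'' \<in> ?W" "p w \<in> V g w''" using p(1)[OF w(1)] cov[OF gc'] by blast
      with dist[OF w(1)] have "p w \<in> V g w" by blast
      then show "w = w'" using dist w eq by simp
    qed
    ultimately have "card ?W \<le> card \<W>" by (intro card_inj_on_le[of "V g"]) (use \<W>(2) in auto)
    then show ?thesis using W \<W> by simp
  qed
  then have "N g = k ^ n" using up[OF gc'] by simp
  moreover have "cover_join n (\<lambda>i. (`) (\<alpha> (inv (h i))) ` U ` {1..k}) = V h ` ?W" for h
    using cover_join_image[of n "\<lambda>i j. \<alpha> (inv (h i)) ` U j" "{1..k}"]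
    by (simp add: image_image V_def)
  then have "max_pattern X G \<alpha> (U ` {1..k}) n = Max {N h | h. h \<in> {1..n} \<rightarrow> carrier G}"
    by (simp add: max_pattern_def N_def)
  \<comment> \<open>The tuples \<open>h\<close> can be infinitely many, but the uniform bound
    \<open>k ^ n\<close> leaves finitely many values, so \<open>Max\<close> is a true
    maximum.\<close>
  moreover have "finite {N h | h. h \<in> {1..n} \<rightarrow> carrier G}"
    by (rule finite_subset[of _ "{..k ^ n}"]) (use up in auto)
  then have "Max {N h | h. h \<in> {1..n} \<rightarrow> carrier G} = N g"
  proof (rule Max_eqI)
    show "N g \<in> {N h | h. h \<in> {1..n} \<rightarrow> carrier G}" using gc' by blast
  qed (use up \<open>N g = k ^ n\<close> in auto)
  ultimately show ?thesis by simp
qed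

text \<open>Distinct entries have disjoint closed balls as neighbourhoods, and the IN property
  supplies the independence sets that \<open>max_pattern_eq\<close> asks of them. The resulting
  cover has entropy exactly \<open>ln k\<close>.\<close>

lemma entropy_ge_of_IN_tuple:
  assumes k: "k \<ge> 1" and z: "z \<in> IN_tuples k X G \<alpha>" and inj: "inj_on z {1..k}"
  shows "ereal (ln (real k)) \<le> max_pattern_entropy X G \<alpha>"
proof -
  obtain M d where "Metric_space M d" and Xd: "X = Metric_space.mtopology M d"
    using metrizable unfolding metrizable_space_def by blast
  then interpret Metric_space M d by simp
  have M: "topspace X = M" by (simp add: Xd)
  have zM: "z j \<in> M" if "j \<in> {1..k}" for j
  proof -
    have "z \<in> {1..k} \<rightarrow>\<^sub>E topspace X" using z unfolding IN_tuples_def by blast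
    then show ?thesis using that M by (metis PiE_mem)
  qed
  \<comment> \<open>The extra 1 gives \<open>Min D\<close> a meaning when \<open>k = 1\<close> and
    there are no pairs.\<close>
  define D where "D = insert 1 ((\<lambda>(i, j). d (z i) (z j)) ` {(i, j) \<in> {1..k} \<times> {1..k}. i \<noteq> j})"
  have "finite {(i, j) \<in> {1..k} \<times> {1..k}. i \<noteq> j}"
    by (rule finite_subset[of _ "{1..k} \<times> {1..k}"]) auto
  then have D: "finite D" "D \<noteq> {}" by (auto simp: D_def)
  \<comment> \<open>Two closed balls of radius \<open>r\<close> that meet have centres at distance
    at most \<open>2 * r\<close>, while distinct centres are at least \<open>3 * r\<close>
    apart.\<close>
  define r where "r = Min D / 3"
  have "d (z i) (z j) > 0" if "i \<in> {1..k}" "j \<in> {1..k}" "i \<noteq> j" for i j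
    using that zM inj by (metis inj_onD mdist_pos_less)
  then have "x > 0" if "x \<in> D" for x using that by (auto simp: D_def)
  then have r: "r > 0" using D by (simp add: r_def)
  have dr: "3 * r \<le> d (z i) (z j)" if "i \<in> {1..k}" "j \<in> {1..k}" "i \<noteq> j" for i j
    using that D by (auto simp: r_def D_def intro!: Min_le)
  define A where "A j = mcball (z j) r" for j
  define U where "U i = M - (\<Union>j\<in>{1..k} - {i}. A j)" for i
  have disj: "A i \<inter> A j = {}" if ij: "i \<in> {1..k}" "j \<in> {1..k}" "i \<noteq> j" for i j
  proof (rule ccontr)
    assume "A i \<inter> A j \<noteq> {}"
    then obtain p where "p \<in> M" "d (z i) p \<le> r" "d (z j) p \<le> r" by (auto simp: A_def)
    then have "d (z i) (z j) \<le> 2 * r"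
      using triangle[of "z i" p "z j"] zM ij commute[of p "z j"] by auto
    then show False using dr[OF ij] r by simp
  qed
  have UM: "(\<Union>j\<in>{1..k}. U j) = M"
  proof (intro equalityI subsetI)
    fix p assume p: "p \<in> M"
    show "p \<in> (\<Union>j\<in>{1..k}. U j)"
    proof (cases "\<exists>i\<in>{1..k}. p \<in> A i")
      case True
      then obtain i where i: "i \<in> {1..k}" "p \<in> A i" by blast
      \<comment> \<open>The balls are disjoint, so \<open>p\<close> lies in none of those removed to
        form \<open>U i\<close>.\<close>
      then have "p \<in> U i" using p disj unfolding U_def by blast
      then show ?thesis using i by blast
    next
      case False
      then have "p \<in> U 1" using p by (auto simp: U_def)
      then show ?thesis using k by auto
    qed
  qed (auto simp: U_def)
  have "openin X (U i)" for i
  proof -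
    have "closedin X (\<Union>j\<in>{1..k} - {i}. A j)"
      unfolding A_def Xd by (intro closedin_Union) auto
    then show ?thesis using M by (auto simp: U_def)
  qed
  then have oc: "open_cover X (U ` {1..k})" using UM M by (auto simp: open_cover_def)
  have A: "A j \<subseteq> topspace X \<and> z j \<in> X interior_of (A j)" if "j \<in> {1..k}" for j
  proof -
    have "mball (z j) r \<subseteq> X interior_of (A j)"
      unfolding A_def Xd by (rule interior_of_maximal) auto
    moreover have "z j \<in> mball (z j) r" using zM[OF that] r by simp
    ultimately show ?thesis by (auto simp: A_def M)
  qed
  have "max_pattern X G \<alpha> (U ` {1..k}) n = k ^ n" if n: "n \<ge> 1" for n
  proof -
    obtain I where "finite I" "n \<le> card I" "independence_set G \<alpha> k A I"
      using z A unfolding IN_tuples_def by blast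
    then show ?thesis using n UM A M by (intro max_pattern_eq[where A = A and I = I]) (auto simp: U_def)
  qed
  then have "1 / real n * ln (real (max_pattern X G \<alpha> (U ` {1..k}) n)) = ln (real k)" if "n \<ge> 1" for n
    using that k by (simp add: ln_realpow)
  \<comment> \<open>The sequence is constant from index 1 on; at \<open>n = 0\<close> the division
    by zero makes the term 0.\<close>
  then have "(\<lambda>n. 1 / real n * ln (real (max_pattern X G \<alpha> (U ` {1..k}) n))) \<longlonglongrightarrow> ln (real k)"
    by (intro tendsto_eventually eventually_sequentiallyI)
  then have "cover_pattern_entropy X G \<alpha> (U ` {1..k}) = ln (real k)"
    unfolding cover_pattern_entropy_def by (rule limI)
  then show ?thesis
    unfolding max_pattern_entropy_def using oc by (intro SUP_upper2[of "U ` {1..k}"]) auto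
qed

end

section \<open>Infinitely many points, and the conclusion\<close>

lemma infinite_topspace_coind_space:
  assumes "x \<in> topspace X" "y \<in> topspace X" "x \<noteq> y" "infinite (rcosets\<^bsub>G\<^esub> H)"
  shows "infinite (topspace (coind_space G H X))"
proof -
  \<comment> \<open>Each coset gives a point of its own, with \<open>y\<close> at that coset and
    \<open>x\<close> at all others.\<close>
  let ?z = "\<lambda>\<theta>. \<lambda>\<theta>'\<in>rcosets\<^bsub>G\<^esub> H. if \<theta>' = \<theta> then y else x"
  have "inj_on ?z (rcosets\<^bsub>G\<^esub> H)"
  proof
    fix a b assume ab: "a \<in> rcosets\<^bsub>G\<^esub> H" "b \<in> rcosets\<^bsub>G\<^esub> H" and "?z a = ?z b"
    then have "?z a a = ?z b a" by simp
    then show "a = b" using ab assms(3) by (simp split: if_splits)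
  qed
  then have "infinite (?z ` (rcosets\<^bsub>G\<^esub> H))" using assms(4) finite_imageD by blast
  moreover have "?z ` (rcosets\<^bsub>G\<^esub> H) \<subseteq> topspace (coind_space G H X)"
    using assms(1,2) by (auto simp: coind_space_def)
  ultimately show ?thesis using finite_subset by blast
qed

theorem theorem3p14:
  fixes G :: "('g, 'm) monoid_scheme" and H :: "'g set" and s :: "'g set \<Rightarrow> 'g"
    and X :: "'x topology" and \<alpha> :: "'g \<Rightarrow> 'x \<Rightarrow> 'x"
  assumes "group G" and "countable (carrier G)" and "infinite (carrier G)"
    and "subgroup H G"
    and "coset_section G H s"
    and "tds (G\<lparr>carrier := H\<rparr>) X \<alpha>"
    and "\<exists>x\<in>topspace X. \<exists>y\<in>topspace X. x \<noteq> y"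
    and "infinite (rcosets\<^bsub>G\<^esub> H)"
  shows "(\<forall>k\<ge>1. IN_tuples k (coind_space G H X) G (coind_action G H s X \<alpha>)
                  = ({1..k} \<rightarrow>\<^sub>E topspace (coind_space G H X)))
       \<and> max_pattern_entropy (coind_space G H X) G (coind_action G H s X \<alpha>) = \<infinity>"
proof
  let ?Y = "coind_space G H X" and ?\<beta> = "coind_action G H s X \<alpha>"
  have IN: "IN_tuples k ?Y G ?\<beta> = ({1..k} \<rightarrow>\<^sub>E topspace ?Y)" for k
    using IN_tuples_coind assms by blast
  then show "\<forall>k\<ge>1. IN_tuples k ?Y G ?\<beta> = ({1..k} \<rightarrow>\<^sub>E topspace ?Y)" by blast
  interpret Y: tds G ?Y ?\<beta> using coind_tds assms by blast
  have inf: "infinite (topspace ?Y)" using infinite_topspace_coind_space assms by metis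
  have ge: "ereal (ln (real k)) \<le> max_pattern_entropy ?Y G ?\<beta>" if k: "k \<ge> 1" for k
  proof -
    obtain B where B: "finite B" "card B = k" "B \<subseteq> topspace ?Y"
      using infinite_arbitrarily_large[OF inf] by blast
    then obtain z where z: "bij_betw z {1..k} B" using ex_bij_betw_nat_finite_1 by blast
    show ?thesis
    proof (rule Y.entropy_ge_of_IN_tuple[OF k])
      \<comment> \<open>Tuples are extensional functions, so the enumeration of \<open>B\<close> has
        to be restricted to \<open>{1..k}\<close>.\<close>
      show "restrict z {1..k} \<in> IN_tuples k ?Y G ?\<beta>"
        unfolding IN using z B(3) bij_betwE by fastforce
      show "inj_on (restrict z {1..k}) {1..k}" using z by (simp add: bij_betw_def inj_on_restrict_eq)
    qed
  qed
  show "max_pattern_entropy ?Y G ?\<beta> = \<infinity>"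
  proof (rule ereal_top)
    fix B :: real
    obtain k :: nat where k: "exp B \<le> real k" using real_arch_simple by blast
    then have "k \<ge> 1" using exp_gt_zero[of B] by (cases k) auto
    then have "B \<le> ln (real k)" using k by (simp add: ln_ge_iff)
    then show "ereal B \<le> max_pattern_entropy ?Y G ?\<beta>"
      using ge[OF \<open>k \<ge> 1\<close>] by (meson ereal_less_eq(3) order_trans)
  qed
qed

end
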